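(* Let $\mathbb{T}_3$ be the $3$-regular tree with root vertex $o$, and let $\mathfrak{K}_4$ be the tetrahedron graph, i.e. the complete graph on $4$ vertices. Let $\Gamma_{\mathfrak{K}_4} < \operatorname{Aut}(\mathbb{T}_3)$ be the fundamental group of $\mathfrak{K}_4$ acting on $\mathbb{T}_3$ by deck automorphisms, and let $\mathcal{P}_{\mathfrak{K}_4}$ be the associated invariant random lattice orbit. Then $$\liminf_{r \to +\infty} \frac{\operatorname{Var}\big(|\mathcal{P}_{\mathfrak{K}_4} \cap B_r(o)|\big)}{|B_r(o)|} = 0,$$ where $r$ ranges over the non-negative integers.
   Context: The tree $\mathbb{T}_3$ is regarded as its vertex set with the graph metric $d$, and $B_r(o)=\{x\in\mathbb{T}_3 : d(x,o)\le r\}$. Its automorphism group $G=\operatorname{Aut}(\mathbb{T}_3)$ carries the topology of pointwise convergence and is a locally compact second countable unimodular group. The universal cover of the finite connected $3$-regular graph $\mathfrak{K}_4$ is $\mathbb{T}_3$ (with $o$ lying over a chosen base vertex), and $\Gamma=\Gamma_{\mathfrak{K}_4}$ is the group of deck transformations of $\mathbb{T}_3\to\mathfrak{K}_4$; it is isomorphic to the fundamental group of $\mathfrak{K}_4$, acts freely on the vertices and is a cocompact lattice in $G$. The invariant random lattice orbit of $\Gamma$ is the random subset $\mathcal{P}_{\mathfrak{K}_4}=g^{-1}\Gamma.o\subset\mathbb{T}_3$, where $\Gamma g$ is distributed according to the unique $G$-invariant Borel probability measure on $\Gamma\backslash G$. *)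

theory Defs
  imports
    "HOL-Probability.Probability"
    "HOL-Algebra.Bij"
    "HOL-Algebra.Coset"
    "Graph_Theory.Graph_Theory"
begin

section \<open>Trees, balls and coverings\<close>

text \<open>
  Undirected simple graphs are symmetric loop-free digraphs whose arcs are pairs of vertices. In
  such a digraph every edge gives rise to a closed walk \<open>u \<rightarrow> v \<rightarrow> u\<close>, which counts as a cycle for
  the digraph library. The cycles of the undirected graph are the digraph cycles of length at least
  three; the library predicate for digraph trees, which forbids the shorter ones too, is unsuitable.
\<close>

definition undirected_tree :: "'v pair_pre_digraph \<Rightarrow> bool" where
  "undirected_tree T \<longleftrightarrow>
     pair_bidirected_digraph T \<and>
     Digraph_Component.connected (with_proj T) \<and>
     \<not> (\<exists>c. pre_digraph.cycle (with_proj T) c \<and> 3 \<le> length c)"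

definition regular_tree :: "nat \<Rightarrow> 'v pair_pre_digraph \<Rightarrow> bool" where
  "regular_tree q T \<longleftrightarrow>
     undirected_tree T \<and> (\<forall>v\<in>pverts T. out_degree (with_proj T) v = q)"

text \<open>The graph metric is the shortest-path distance with all arcs of weight one.\<close>

definition graph_ball :: "'v pair_pre_digraph \<Rightarrow> 'v \<Rightarrow> nat \<Rightarrow> 'v set" where
  "graph_ball T v r =
     {x \<in> pverts T. wf_digraph.\<mu> (with_proj T) (\<lambda>_. 1) x v \<le> ereal (real r)}"

text \<open>
  Covering maps of simple graphs, given on vertices. The bijection between neighbourhoods makes
  \<open>p\<close> a graph homomorphism. When \<open>T\<close> is a tree, such a map is a universal covering of \<open>K\<close>.
\<close>

definition covering_map ::
  "'v pair_pre_digraph \<Rightarrow> 'k pair_pre_digraph \<Rightarrow> ('v \<Rightarrow> 'k) \<Rightarrow> bool" where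
  "covering_map T K p \<longleftrightarrow>
     p ` pverts T = pverts K \<and>
     (\<forall>v\<in>pverts T. bij_betw p {w. (v, w) \<in> parcs T} {w. (p v, w) \<in> parcs K})"


section \<open>Automorphism group and deck transformations\<close>

definition graph_Aut :: "'v pair_pre_digraph \<Rightarrow> ('v \<Rightarrow> 'v) monoid" where
  "graph_Aut T = (BijGroup (pverts T))
     \<lparr>carrier := {g \<in> Bij (pverts T).
        \<forall>u\<in>pverts T. \<forall>v\<in>pverts T. (g u, g v) \<in> parcs T \<longleftrightarrow> (u, v) \<in> parcs T}\<rparr>"

definition deck_group ::
  "'v pair_pre_digraph \<Rightarrow> ('v \<Rightarrow> 'k) \<Rightarrow> ('v \<Rightarrow> 'v) set" where
  "deck_group T p = {g \<in> carrier (graph_Aut T). \<forall>v\<in>pverts T. p (g v) = p v}"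

text \<open>Pointwise convergence, the vertex set being discrete.\<close>

definition graph_Aut_topology :: "'v pair_pre_digraph \<Rightarrow> ('v \<Rightarrow> 'v) topology" where
  "graph_Aut_topology T =
     subtopology (product_topology (\<lambda>_. discrete_topology (pverts T)) (pverts T))
       (carrier (graph_Aut T))"


section \<open>Invariant probability measures on coset spaces\<close>

text \<open>The quotient topology on the space of right cosets of \<open>H\<close>, where \<open>X\<close> is a topology on \<open>G\<close>.\<close>

definition coset_topology ::
  "('a, 'b) monoid_scheme \<Rightarrow> 'a topology \<Rightarrow> 'a set \<Rightarrow> 'a set topology" where
  "coset_topology G X H =
     topology (\<lambda>U. U \<subseteq> rcosets\<^bsub>G\<^esub> H \<and> openin X {g \<in> topspace X. H #>\<^bsub>G\<^esub> g \<in> U})"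

definition borel_of :: "'a topology \<Rightarrow> 'a measure" where
  "borel_of X = sigma (topspace X) {U. openin X U}"

definition invariant_coset_prob ::
  "('a, 'b) monoid_scheme \<Rightarrow> 'a topology \<Rightarrow> 'a set \<Rightarrow> 'a set measure \<Rightarrow> bool" where
  "invariant_coset_prob G X H M \<longleftrightarrow>
     prob_space M \<and>
     sets M = sets (borel_of (coset_topology G X H)) \<and>
     (\<forall>h\<in>carrier G. distr M M (\<lambda>C. C #>\<^bsub>G\<^esub> h) = M)"

text \<open>
  The lattice orbit attached to a coset \<open>C = \<Gamma>g\<close>. All representatives \<open>g \<in> C\<close> yield the same set
  \<open>g\<inverse>\<Gamma>.v\<close> (lemma \<open>lattice_orbit_rcoset\<close> below), so taking the union over them is harmless.
\<close>

definition lattice_orbit ::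
  "'v pair_pre_digraph \<Rightarrow> ('v \<Rightarrow> 'v) set \<Rightarrow> 'v \<Rightarrow> ('v \<Rightarrow> 'v) set \<Rightarrow> 'v set" where
  "lattice_orbit T \<Gamma> v C = {(inv\<^bsub>graph_Aut T\<^esub> g) (\<gamma> v) | g \<gamma>. g \<in> C \<and> \<gamma> \<in> \<Gamma>}"


section \<open>Well-definedness\<close>

lemma openin_coset_topology:
  "openin (coset_topology G X H) U \<longleftrightarrow>
     U \<subseteq> rcosets\<^bsub>G\<^esub> H \<and> openin X {g \<in> topspace X. H #>\<^bsub>G\<^esub> g \<in> U}"
proof -
  let ?P = "\<lambda>U. U \<subseteq> rcosets\<^bsub>G\<^esub> H \<and> openin X {g \<in> topspace X. H #>\<^bsub>G\<^esub> g \<in> U}"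
  have "istopology ?P"
    unfolding istopology_def
  proof (intro conjI allI impI)
    fix S S' assume S: "?P S" "?P S'"
    have "{g \<in> topspace X. H #>\<^bsub>G\<^esub> g \<in> S \<inter> S'} =
        {g \<in> topspace X. H #>\<^bsub>G\<^esub> g \<in> S} \<inter> {g \<in> topspace X. H #>\<^bsub>G\<^esub> g \<in> S'}"
      by auto
    then show "openin X {g \<in> topspace X. H #>\<^bsub>G\<^esub> g \<in> S \<inter> S'}"
      using S by (simp add: openin_Int)
    show "S \<inter> S' \<subseteq> rcosets\<^bsub>G\<^esub> H"
      using S by auto
  next
    fix \<K> assume K: "\<forall>S\<in>\<K>. ?P S"
    have "{g \<in> topspace X. H #>\<^bsub>G\<^esub> g \<in> \<Union>\<K>} =
        (\<Union>S\<in>\<K>. {g \<in> topspace X. H #>\<^bsub>G\<^esub> g \<in> S})"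
      by auto
    then show "openin X {g \<in> topspace X. H #>\<^bsub>G\<^esub> g \<in> \<Union>\<K>}"
      using K by (auto intro: openin_Union)
    show "\<Union>\<K> \<subseteq> rcosets\<^bsub>G\<^esub> H"
      using K by auto
  qed
  then show ?thesis
    unfolding coset_topology_def by (simp add: topology_inverse')
qed

lemma topspace_graph_Aut_topology: "topspace (graph_Aut_topology T) = carrier (graph_Aut T)"
proof -
  have "carrier (graph_Aut T) \<subseteq> (\<Pi>\<^sub>E _\<in>pverts T. pverts T)"
    by (auto simp: graph_Aut_def Bij_def PiE_def bij_betw_def)
  then show ?thesis
    unfolding graph_Aut_topology_def by auto
qed

lemma topspace_coset_topology:
  assumes "topspace X = carrier G"
  shows "topspace (coset_topology G X H) = rcosets\<^bsub>G\<^esub> H"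
proof
  show "topspace (coset_topology G X H) \<subseteq> rcosets\<^bsub>G\<^esub> H"
    using openin_coset_topology[of G X H] openin_topspace by blast
  have "{g \<in> topspace X. H #>\<^bsub>G\<^esub> g \<in> rcosets\<^bsub>G\<^esub> H} = topspace X"
    using assms by (auto simp: RCOSETS_def)
  then have "openin (coset_topology G X H) (rcosets\<^bsub>G\<^esub> H)"
    by (simp add: openin_coset_topology)
  then show "rcosets\<^bsub>G\<^esub> H \<subseteq> topspace (coset_topology G X H)"
    by (rule openin_subset)
qed

lemma graph_Aut_subgroup: "subgroup (carrier (graph_Aut T)) (BijGroup (pverts T))"
proof -
  interpret B: group "BijGroup (pverts T)" by (rule group_BijGroup)
  show ?thesis
  proof (rule B.subgroupI)
    show "carrier (graph_Aut T) \<subseteq> carrier (BijGroup (pverts T))"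
      by (auto simp: graph_Aut_def BijGroup_def)
    have "(\<lambda>x\<in>pverts T. x) \<in> carrier (graph_Aut T)"
      by (auto simp: graph_Aut_def id_Bij)
    then show "carrier (graph_Aut T) \<noteq> {}" by blast
  next
    fix g assume g: "g \<in> carrier (graph_Aut T)"
    then have gB: "g \<in> Bij (pverts T)" by (simp add: graph_Aut_def)
    have inv: "inv\<^bsub>BijGroup (pverts T)\<^esub> g = restrict (inv_into (pverts T) g) (pverts T)"
      using gB by (simp add: inv_BijGroup)
    have "g (inv_into (pverts T) g u) = u" if "u \<in> pverts T" for u
      using gB that by (auto simp: Bij_def bij_betw_def f_inv_into_f)
    then show "inv\<^bsub>BijGroup (pverts T)\<^esub> g \<in> carrier (graph_Aut T)"
      using g gB Bij_inv_into_mem[OF gB] unfolding inv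
      by (auto simp: graph_Aut_def restrict_inv_into_Bij) metis+
  next
    fix g h assume gh: "g \<in> carrier (graph_Aut T)" "h \<in> carrier (graph_Aut T)"
    then have "h x \<in> pverts T" if "x \<in> pverts T" for x
      using that Bij_imp_funcset[of h "pverts T"] by (auto simp: graph_Aut_def)
    with gh show "g \<otimes>\<^bsub>BijGroup (pverts T)\<^esub> h \<in> carrier (graph_Aut T)"
      by (simp add: graph_Aut_def BijGroup_def compose_Bij compose_eq)
  qed
qed

lemma group_graph_Aut: "group (graph_Aut T)"
proof -
  have "graph_Aut T = (BijGroup (pverts T))\<lparr>carrier := carrier (graph_Aut T)\<rparr>"
    by (simp add: graph_Aut_def)
  then show ?thesis
    using subgroup.subgroup_is_group[OF graph_Aut_subgroup group_BijGroup] by metis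
qed

lemma mult_graph_Aut:
  assumes "g \<in> carrier (graph_Aut T)" "h \<in> carrier (graph_Aut T)" "x \<in> pverts T"
  shows "(g \<otimes>\<^bsub>graph_Aut T\<^esub> h) x = g (h x)"
  using assms by (auto simp: graph_Aut_def BijGroup_def compose_eq)

lemma graph_Aut_in_verts:
  assumes "g \<in> carrier (graph_Aut T)" "x \<in> pverts T"
  shows "g x \<in> pverts T"
  using assms Bij_imp_funcset[of g "pverts T"] by (auto simp: graph_Aut_def)

lemma subgroup_deck_group: "subgroup (deck_group T p) (graph_Aut T)"
proof -
  interpret A: group "graph_Aut T" by (rule group_graph_Aut)
  show ?thesis
  proof (rule A.subgroupI)
    show "deck_group T p \<subseteq> carrier (graph_Aut T)" by (auto simp: deck_group_def)
    have "\<one>\<^bsub>graph_Aut T\<^esub> \<in> deck_group T p"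
      using A.one_closed by (auto simp: deck_group_def graph_Aut_def BijGroup_def)
    then show "deck_group T p \<noteq> {}" by blast
  next
    fix g assume "g \<in> deck_group T p"
    then have g: "g \<in> carrier (graph_Aut T)" "\<And>v. v \<in> pverts T \<Longrightarrow> p (g v) = p v"
      by (auto simp: deck_group_def)
    let ?i = "inv\<^bsub>graph_Aut T\<^esub> g"
    have "p (?i v) = p v" if v: "v \<in> pverts T" for v
    proof -
      have "g (?i v) = (g \<otimes>\<^bsub>graph_Aut T\<^esub> ?i) v"
        using mult_graph_Aut[OF g(1) A.inv_closed[OF g(1)] v] by simp
      also have "\<dots> = v"
        unfolding A.r_inv[OF g(1)] using v by (simp add: graph_Aut_def BijGroup_def)
      finally show ?thesis
        using g(2)[of "?i v"] graph_Aut_in_verts[OF A.inv_closed[OF g(1)] v] by simp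
    qed
    then show "?i \<in> deck_group T p" using g by (auto simp: deck_group_def)
  next
    fix g h assume "g \<in> deck_group T p" "h \<in> deck_group T p"
    then show "g \<otimes>\<^bsub>graph_Aut T\<^esub> h \<in> deck_group T p"
      by (auto simp: deck_group_def mult_graph_Aut graph_Aut_in_verts)
  qed
qed

lemma lattice_orbit_rcoset:
  assumes \<Gamma>: "subgroup \<Gamma> (graph_Aut T)" and g: "g \<in> carrier (graph_Aut T)" and v: "v \<in> pverts T"
  shows "lattice_orbit T \<Gamma> v (\<Gamma> #>\<^bsub>graph_Aut T\<^esub> g) =
    (inv\<^bsub>graph_Aut T\<^esub> g) ` ((\<lambda>\<gamma>. \<gamma> v) ` \<Gamma>)"
proof -
  interpret A: group "graph_Aut T" by (rule group_graph_Aut)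
  interpret S: subgroup \<Gamma> "graph_Aut T" by (rule \<Gamma>)
  have eq: "(inv\<^bsub>graph_Aut T\<^esub> (\<delta> \<otimes>\<^bsub>graph_Aut T\<^esub> g)) (\<gamma> v) =
      (inv\<^bsub>graph_Aut T\<^esub> g) ((inv\<^bsub>graph_Aut T\<^esub> \<delta> \<otimes>\<^bsub>graph_Aut T\<^esub> \<gamma>) v)"
    if "\<delta> \<in> \<Gamma>" "\<gamma> \<in> \<Gamma>" for \<delta> \<gamma>
    using that g v by (simp add: A.inv_mult_group mult_graph_Aut graph_Aut_in_verts)
  show ?thesis
  proof (intro equalityI subsetI)
    fix x assume "x \<in> lattice_orbit T \<Gamma> v (\<Gamma> #>\<^bsub>graph_Aut T\<^esub> g)"
    then obtain \<delta> \<gamma> where d: "\<delta> \<in> \<Gamma>" "\<gamma> \<in> \<Gamma>"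
      and x: "x = (inv\<^bsub>graph_Aut T\<^esub> (\<delta> \<otimes>\<^bsub>graph_Aut T\<^esub> g)) (\<gamma> v)"
      by (auto simp: lattice_orbit_def r_coset_def)
    have "inv\<^bsub>graph_Aut T\<^esub> \<delta> \<otimes>\<^bsub>graph_Aut T\<^esub> \<gamma> \<in> \<Gamma>"
      using d by (simp add: S.m_closed S.m_inv_closed)
    then show "x \<in> (inv\<^bsub>graph_Aut T\<^esub> g) ` ((\<lambda>\<gamma>. \<gamma> v) ` \<Gamma>)"
      using x eq[OF d] by auto
  next
    fix x assume "x \<in> (inv\<^bsub>graph_Aut T\<^esub> g) ` ((\<lambda>\<gamma>. \<gamma> v) ` \<Gamma>)"
    then obtain \<gamma> where "\<gamma> \<in> \<Gamma>" "x = (inv\<^bsub>graph_Aut T\<^esub> g) (\<gamma> v)" by auto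
    moreover have "g \<in> \<Gamma> #>\<^bsub>graph_Aut T\<^esub> g"
      using A.rcos_self[OF g \<Gamma>] .
    ultimately show "x \<in> lattice_orbit T \<Gamma> v (\<Gamma> #>\<^bsub>graph_Aut T\<^esub> g)"
      by (auto simp: lattice_orbit_def)
  qed
qed

end

theory Submission
  imports Defs
begin

text \<open>
  Since \<open>\<Gamma>\<close> acts transitively on the fibres of \<open>p\<close>, the part of the random orbit of \<open>\<Gamma>g\<close> in
  \<open>B\<^sub>r(o)\<close> consists of the \<open>x\<close> with \<open>p (g x) = p o\<close>. As \<open>p \<circ> g\<close> is again a covering and vertices of a
  tree correspond to non-backtracking walks from a base point, its size is the number of
  non-backtracking walks of length at most \<open>r\<close> in the tetrahedron from \<open>p (g o)\<close> to \<open>p o\<close>. By the symmetry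
  of the complete graph this takes only two values, according to whether \<open>p (g o) = p o\<close>, so the
  variance is at most the square of their difference. With \<open>r = n + 1\<close> that difference is, up to sign,
  twice the Lucas sequence \<open>L 0 = 0\<close>, \<open>L 1 = 1\<close>, \<open>L (n + 2) = - L (n + 1) - 2 L n\<close>, that is \<open>4 / \<surd>7 \<cdot> Im (w ^ n)\<close> for
  \<open>w = (- 1 + i \<surd>7) / 2\<close>. As \<open>\<bar>w\<bar>\<^sup>2 = 2\<close> and the ball has at least \<open>2 ^ n\<close> elements, the quotient is at
  most \<open>16 / 7 \<cdot> (Im (z ^ n))\<^sup>2\<close> with \<open>z = w / \<bar>w\<bar>\<close> on the unit circle, and by compactness of the circle
  the powers of \<open>z\<close> return arbitrarily close to \<open>1\<close> infinitely often.
\<close>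

section \<open>Non-backtracking walks in trees\<close>

text \<open>
  Non-backtracking walks are read backwards: the base point is the last entry of the list, so that
  extending a walk by one step is a \<open>Cons\<close>.
\<close>

fun nb_walk :: "'v pair_pre_digraph \<Rightarrow> 'v list \<Rightarrow> bool" where
  "nb_walk G [] \<longleftrightarrow> False"
| "nb_walk G [x] \<longleftrightarrow> x \<in> pverts G"
| "nb_walk G (x # y # zs) \<longleftrightarrow>
     (y, x) \<in> parcs G \<and> nb_walk G (y # zs) \<and> (zs \<noteq> [] \<longrightarrow> hd zs \<noteq> x)"

lemma nb_walk_Cons:
  assumes "ys \<noteq> []"
  shows "nb_walk G (x # ys) \<longleftrightarrow>
    (hd ys, x) \<in> parcs G \<and> nb_walk G ys \<and> (tl ys \<noteq> [] \<longrightarrow> hd (tl ys) \<noteq> x)"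
  using assms by (cases ys) auto

text \<open>Cuts a closed piece out of a longer walk in \<open>nb_walk_distinct\<close>.
  Well-formedness serves the one-vertex prefix, whose entry is a vertex only because an arc of the
  longer walk ends there.\<close>

lemma nb_walk_prefix: "nb_walk G (xs @ ys) \<Longrightarrow> xs \<noteq> [] \<Longrightarrow> pair_wf_digraph G \<Longrightarrow> nb_walk G xs"
proof (induction xs)
  case (Cons x xs)
  show ?case
  proof (cases "xs = []")
    case True
    with Cons.prems show ?thesis
      by (cases ys) (auto dest: pair_wf_digraph.in_arcsD2)
  next
    case False
    with Cons show ?thesis by (cases "tl xs = []") (auto simp: nb_walk_Cons)
  qed
qed simp

text \<open>The first walk is traversed backwards, hence the symmetry; the condition on heads says
  that the junction \<open>v\<close> is no backtrack. The induction moves the junction along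
  \<open>xs\<close>: at the next junction \<open>a\<close> the neighbours are \<open>v\<close> and
  the entry after \<open>a\<close>, which differ because \<open>v # a # xs\<close> does not
  backtrack.\<close>

lemma nb_walk_join:
  assumes "symmetric (with_proj G)" "nb_walk G (v # xs)" "nb_walk G (v # ys)"
    and "xs \<noteq> [] \<Longrightarrow> ys \<noteq> [] \<Longrightarrow> hd xs \<noteq> hd ys"
  shows "nb_walk G (rev xs @ v # ys)"
  using assms(2-)
proof (induction xs arbitrary: v ys)
  case (Cons a xs)
  have "(v, a) \<in> parcs G"
    using Cons.prems(1) assms(1) by (auto simp: symmetric_def sym_def)
  then have "nb_walk G (rev xs @ a # v # ys)"
    using Cons.prems by (intro Cons.IH) (auto simp: nb_walk_Cons)
  then show ?case by simp
qed simp


lemma nb_walk_in_verts: "pair_wf_digraph G \<Longrightarrow> nb_walk G xs \<Longrightarrow> set xs \<subseteq> pverts G"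
  by (induction xs rule: induct_list012) (auto dest: pair_wf_digraph.in_arcsD2)

lemma length_vwalk_arcs: "length (vwalk_arcs xs) = length xs - 1"
  by (induction xs rule: vwalk_arcs.induct) auto

text \<open>The library walk runs in list order, against the arcs that \<open>nb_walk\<close>
  records, so symmetry is used to turn the arcs around.\<close>

lemma nb_walk_awalk:
  assumes "symmetric (with_proj G)" "pair_wf_digraph G" "nb_walk G xs"
  shows "pre_digraph.awalk (with_proj G) (hd xs) (vwalk_arcs xs) (last xs) \<and>
    pawalk_verts (hd xs) (vwalk_arcs xs) = xs"
  using assms(3)
proof (induction xs rule: induct_list012)
  case (3 x y zs)
  have "(x, y) \<in> parcs G" and wf: "nb_walk G (y # zs)"
    using 3 assms(1) by (auto simp: symmetric_def sym_def)
  moreover have "x \<in> pverts G"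
    using nb_walk_in_verts[OF assms(2) 3(3)] by simp
  ultimately show ?case using 3
    by (auto simp: pre_digraph.awalk_def cas_with_proj_eq)
qed (auto simp: pre_digraph.awalk_def cas_with_proj_eq)

lemma undirected_treeD:
  assumes "undirected_tree T"
  shows "symmetric (with_proj T)" "pair_wf_digraph T" "\<And>x. (x, x) \<notin> parcs T"
    "\<And>x y. (x, y) \<in> parcs T \<Longrightarrow> (y, x) \<in> parcs T"
    "\<And>c. pre_digraph.cycle (with_proj T) c \<Longrightarrow> length c < 3"
    "\<And>x y. x \<in> pverts T \<Longrightarrow> y \<in> pverts T \<Longrightarrow> \<exists>c. pre_digraph.awalk (with_proj T) x c y"
proof -
  interpret pair_bidirected_digraph T
    using assms by (simp add: undirected_tree_def)
  show sym: "symmetric (with_proj T)" and "pair_wf_digraph T" and "\<And>x. (x, x) \<notin> parcs T"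
    using pair_no_loops by (fastforce intro: pair_sym_arcs pair_wf_digraph_axioms)+
  show "\<And>x y. (x, y) \<in> parcs T \<Longrightarrow> (y, x) \<in> parcs T"
    using sym by (auto simp: symmetric_def sym_def)
  show "\<And>c. pre_digraph.cycle (with_proj T) c \<Longrightarrow> length c < 3"
    using assms by (auto simp: undirected_tree_def not_le)
  show "\<exists>c. pre_digraph.awalk (with_proj T) x c y" if "x \<in> pverts T" "y \<in> pverts T" for x y
  proof -
    \<comment> \<open>Library connectedness is strong connectedness of the symmetric closure, which
      for a symmetric digraph is the digraph itself.\<close>
    have "parcs (mk_symmetric (with_proj T)) = parcs T"
      using sym by (auto simp: mk_symmetric_def symmetric_def sym_def)
    then have "mk_symmetric (with_proj T) = T"
      by (simp add: mk_symmetric_def)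
    then have "x \<rightarrow>\<^sup>*\<^bsub>with_proj T\<^esub> y"
      using assms that
      by (auto simp: undirected_tree_def Digraph_Component.connected_def strongly_connected_def)
    then show ?thesis by (simp add: reachable_awalk)
  qed
qed

text \<open>By induction only the newest vertex \<open>x\<close> can be a repetition. The stretch up
  to its other occurrence is then a cycle: no shorter than three arcs, since one arc would be a loop
  and two a backtrack.\<close>

lemma nb_walk_distinct:
  assumes T: "undirected_tree T" and "nb_walk T xs"
  shows "distinct xs"
  using assms(2)
proof (induction xs)
  case (Cons x xs)
  note T = undirected_treeD[OF T]
  show ?case
  proof (cases "xs = []")
    case False
    then have d: "distinct xs"
      using Cons by (simp add: nb_walk_Cons)
    have "x \<notin> set xs"
    proof
      assume "x \<in> set xs"
      then obtain as bs where xs: "xs = as @ x # bs"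
        by (meson split_list)
      let ?c = "x # as @ [x]"
      have nb: "nb_walk T ?c"
        using nb_walk_prefix[of T ?c bs] Cons.prems T(2) by (simp add: xs)
      have "as \<noteq> []"
        using nb T(3) by auto
      moreover have "as \<noteq> [a]" for a
        using nb by auto
      ultimately have "2 \<le> length as"
        by (metis One_nat_def Suc_1 Suc_leI length_0_conv length_Suc_conv less_2_cases not_le)
      moreover have "pre_digraph.cycle (with_proj T) (vwalk_arcs ?c)"
      proof -
        have *: "pre_digraph.awalk (with_proj T) x (vwalk_arcs ?c) x"
          "pawalk_verts x (vwalk_arcs ?c) = ?c"
          using nb_walk_awalk[OF T(1,2) nb] by auto
        have "distinct (tl (pawalk_verts x (vwalk_arcs ?c)))"
          unfolding * using d by (auto simp: xs)
        moreover have "vwalk_arcs ?c \<noteq> []"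
          using length_vwalk_arcs[of ?c] by auto
        ultimately show ?thesis
          using *(1) unfolding pre_digraph.cycle_def awalk_verts_with_proj_eq by blast
      qed
      ultimately show False
        using T(5)[of "vwalk_arcs ?c"] by (simp add: length_vwalk_arcs)
    qed
    with d show ?thesis by simp
  qed simp
qed simp

text \<open>Where two walks with common ends first differ, reversing one and joining it to the other
  gives a non-backtracking walk that meets the common last vertex twice, against
  \<open>nb_walk_distinct\<close>.\<close>

lemma nb_walk_unique:
  assumes T: "undirected_tree T"
    and "nb_walk T xs" "nb_walk T ys" "hd xs = hd ys" "last xs = last ys"
  shows "xs = ys"
  using assms(2-)
proof (induction xs arbitrary: ys)
  case (Cons v xs)
  then obtain zs where ys: "ys = v # zs"
    by (cases ys) auto
  have d: "distinct (v # xs)" "distinct (v # zs)"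
    using nb_walk_distinct[OF T Cons.prems(1)] nb_walk_distinct[OF T Cons.prems(2)] ys
    by (simp_all del: distinct.simps)
  show ?case
  proof (cases "xs = [] \<or> zs = []")
    case True
    then show ?thesis
      using Cons.prems(4) d ys by (auto split: if_splits dest: last_in_set)
  next
    case False
    then have last: "last xs = last zs"
      using Cons.prems ys by simp
    show ?thesis
    proof (cases "hd xs = hd zs")
      case True
      then have "xs = zs"
        using Cons ys False last by (auto simp: nb_walk_Cons)
      then show ?thesis using ys by simp
    next
      case neq: False
      have "nb_walk T (rev xs @ v # zs)"
        using Cons.prems neq ys undirected_treeD(1)[OF T] by (intro nb_walk_join) auto
      then have "set xs \<inter> set zs = {}"
        using nb_walk_distinct[OF T] by fastforce
      then show ?thesis
        using False last last_in_set by fastforce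
    qed
  qed
qed simp

section \<open>Balls as sets of non-backtracking walks\<close>

lemma awalk_imp_nb_walk:
  assumes G: "symmetric (with_proj G)" "pair_wf_digraph G" and "pre_digraph.awalk (with_proj G) v c x"
  shows "\<exists>xs. nb_walk G xs \<and> hd xs = v \<and> last xs = x \<and> length xs \<le> Suc (length c)"
  using assms(3)
proof (induction c arbitrary: v)
  case Nil
  then show ?case
    by (intro exI[of _ "[v]"]) (auto simp: pre_digraph.awalk_def cas_with_proj_eq)
next
  case (Cons a c)
  have a: "fst a = v" "a \<in> parcs G" "pre_digraph.awalk (with_proj G) (snd a) c x"
    using Cons.prems pair_wf_digraph.arc_snd_in_verts[OF G(2), of a]
    by (auto simp: pre_digraph.awalk_def cas_with_proj_eq)
  have va: "(snd a, v) \<in> parcs G" "v \<in> pverts G"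
    using a(1,2) G pair_wf_digraph.arc_fst_in_verts[OF G(2) a(2)]
    by (cases a; auto simp: symmetric_def sym_def)+
  obtain ys where ys: "nb_walk G ys" "hd ys = snd a" "last ys = x" "length ys \<le> Suc (length c)"
    using Cons.IH[OF a(3)] by blast
  \<comment> \<open>If prepending \<open>v\<close> would create a backtrack, dropping the head of
    \<open>ys\<close> already leaves a walk that starts at \<open>v\<close>; otherwise
    \<open>v\<close> is prepended.\<close>
  show ?case
  proof (cases "tl ys \<noteq> [] \<and> hd (tl ys) = v")
    case True
    then have "nb_walk G (tl ys) \<and> last (tl ys) = x \<and> length (tl ys) \<le> Suc (length (a # c))"
      using ys by (cases ys) (auto simp: nb_walk_Cons)
    with True show ?thesis by blast
  next
    case False
    have "ys \<noteq> []" using ys by auto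
    with False have "nb_walk G (v # ys)"
      using ys va by (auto simp: nb_walk_Cons)
    with ys \<open>ys \<noteq> []\<close> show ?thesis
      by (intro exI[of _ "v # ys"]) auto
  qed
qed

lemma mem_graph_ball_iff:
  assumes G: "symmetric (with_proj G)" "pair_wf_digraph G"
  shows "x \<in> graph_ball G v r \<longleftrightarrow>
    (\<exists>xs. nb_walk G xs \<and> hd xs = x \<and> last xs = v \<and> length xs \<le> Suc r)"
proof -
  have wf: "wf_digraph (with_proj G)"
    using G(2) by (simp add: wf_digraph_wp_iff)
  have cost: "wf_digraph.awalk_cost (\<lambda>_. 1) c = real (length c)" for c :: "('a \<times> 'a) list"
    by (simp add: wf_digraph.awalk_cost_def[OF wf] sum_list_triv)
  have "wf_digraph.\<mu> (with_proj G) (\<lambda>_. 1) x v \<le> ereal (real r) \<longleftrightarrow>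
      (\<exists>c. pre_digraph.awalk (with_proj G) x c v \<and> length c \<le> r)" (is "?L \<longleftrightarrow> ?R")
  proof
    assume ?L
    \<comment> \<open>A strict bound on the infimum yields a witness without any argument that the
      infimum is attained; integrality of the length turns the bound below \<open>Suc r\<close> back
      into at most \<open>r\<close>.\<close>
    then have "wf_digraph.\<mu> (with_proj G) (\<lambda>_. 1) x v < ereal (real (Suc r))"
      by (rule le_less_trans) simp
    then show ?R
      by (auto simp: wf_digraph.\<mu>_def[OF wf] INF_less_iff cost)
  next
    assume ?R
    then show ?L
      by (auto simp: wf_digraph.\<mu>_def[OF wf] cost intro!: INF_lower2)
  qed
  then have "x \<in> graph_ball G v r \<longleftrightarrow>
      x \<in> pverts G \<and> (\<exists>c. pre_digraph.awalk (with_proj G) x c v \<and> length c \<le> r)"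
    by (simp add: graph_ball_def)
  also have "\<dots> \<longleftrightarrow> (\<exists>xs. nb_walk G xs \<and> hd xs = x \<and> last xs = v \<and> length xs \<le> Suc r)"
    (is "?L \<longleftrightarrow> ?R")
  proof
    assume ?L
    then show ?R
      by (meson G awalk_imp_nb_walk le_trans Suc_le_mono)
  next
    assume ?R
    then obtain xs where xs: "nb_walk G xs" "hd xs = x" "last xs = v" "length xs \<le> Suc r"
      by blast
    then have "x \<in> pverts G"
      using nb_walk_in_verts[OF G(2) xs(1)] by (cases xs) auto
    then show ?L
      using nb_walk_awalk[OF G xs(1)] xs length_vwalk_arcs[of xs] by auto
  qed
  finally show ?thesis .
qed

lemma card_graph_ball:
  assumes T: "undirected_tree T"
  shows "card {x \<in> graph_ball T v r. P x} =
    card {xs. nb_walk T xs \<and> last xs = v \<and> length xs \<le> Suc r \<and> P (hd xs)}" (is "_ = card ?W")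
proof -
  have "{x \<in> graph_ball T v r. P x} = hd ` ?W"
    by (auto simp: mem_graph_ball_iff[OF undirected_treeD(1,2)[OF T]])
  moreover have "inj_on hd ?W"
    by (rule inj_onI) (auto intro: nb_walk_unique[OF T])
  ultimately show ?thesis by (simp add: card_image)
qed


section \<open>Lifting walks along coverings\<close>

lemma covering_mapD:
  assumes "covering_map T K p" "pair_wf_digraph T"
  shows "v \<in> pverts T \<Longrightarrow> p v \<in> pverts K"
    and "(v, w) \<in> parcs T \<Longrightarrow> (p v, p w) \<in> parcs K"
    and "(v, w) \<in> parcs T \<Longrightarrow> (v, w') \<in> parcs T \<Longrightarrow> p w = p w' \<longleftrightarrow> w = w'"
    and "v \<in> pverts T \<Longrightarrow> (p v, k) \<in> parcs K \<Longrightarrow> \<exists>w. (v, w) \<in> parcs T \<and> p w = k"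
proof -
  have bij: "bij_betw p {w. (v, w) \<in> parcs T} {w. (p v, w) \<in> parcs K}" if "v \<in> pverts T" for v
    using assms(1) that by (simp add: covering_map_def)
  have V: "(v, w) \<in> parcs T \<Longrightarrow> v \<in> pverts T" for v w
    using assms(2) by (rule pair_wf_digraph.in_arcsD1)
  show "v \<in> pverts T \<Longrightarrow> p v \<in> pverts K"
    using assms(1) by (auto simp: covering_map_def)
  show "(v, w) \<in> parcs T \<Longrightarrow> (p v, p w) \<in> parcs K"
    using bij_betw_imp_surj_on[OF bij[OF V, of v w]] by auto
  show "(v, w) \<in> parcs T \<Longrightarrow> (v, w') \<in> parcs T \<Longrightarrow> p w = p w' \<longleftrightarrow> w = w'"
    using bij_betw_imp_inj_on[OF bij[OF V, of v w]] by (auto simp: inj_on_def)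
  show "v \<in> pverts T \<Longrightarrow> (p v, k) \<in> parcs K \<Longrightarrow> \<exists>w. (v, w) \<in> parcs T \<and> p w = k"
    using bij_betw_imp_surj_on[OF bij[of v]] by (metis (mono_tags) imageE mem_Collect_eq)
qed

text \<open>Two distinct neighbours of a vertex keep distinct images by local injectivity, so no
  backtrack appears in the image.\<close>

lemma nb_walk_map_covering:
  assumes p: "covering_map T K p" "pair_wf_digraph T" and sym: "symmetric (with_proj T)"
    and "nb_walk T xs"
  shows "nb_walk K (map p xs)"
  using assms(4)
proof (induction xs rule: induct_list012)
  case (3 x y zs)
  note D = covering_mapD[OF p]
  have "p (hd zs) \<noteq> p x" if "zs \<noteq> []"
  proof -
    have "(y, hd zs) \<in> parcs T" "hd zs \<noteq> x" "(y, x) \<in> parcs T"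
      using 3(3) that sym by (auto simp: nb_walk_Cons symmetric_def sym_def)
    then show ?thesis using D(3) by blast
  qed
  with 3 show ?case
    by (auto simp: D hd_map)
qed (auto simp: covering_mapD[OF p])

lemma nb_walk_lift_unique:
  assumes p: "covering_map T K p" "pair_wf_digraph T"
    and "nb_walk T xs" "nb_walk T ys" "last xs = last ys" "map p xs = map p ys"
  shows "xs = ys"
  using assms(3-)
proof (induction xs arbitrary: ys)
  case (Cons x xs)
  obtain y zs where ys: "ys = y # zs" "p x = p y" "map p xs = map p zs"
    using Cons.prems(4) by auto
  show ?case
  proof (cases "xs = []")
    case True
    then show ?thesis using ys Cons.prems by simp
  next
    case False
    then have "zs \<noteq> []" using ys by auto
    with False have "xs = zs"
      using Cons.prems ys by (intro Cons.IH) (auto simp: nb_walk_Cons)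
    moreover have "(hd xs, x) \<in> parcs T" "(hd zs, y) \<in> parcs T"
      using Cons.prems False \<open>zs \<noteq> []\<close> ys by (auto simp: nb_walk_Cons)
    ultimately show ?thesis
      using covering_mapD(3)[OF p] ys by blast
  qed
qed simp

lemma nb_walk_lift:
  assumes p: "covering_map T K p" "pair_wf_digraph T" and "x \<in> pverts T"
    and "nb_walk K ks" "last ks = p x"
  shows "\<exists>xs. nb_walk T xs \<and> last xs = x \<and> map p xs = ks"
  using assms(4-)
proof (induction ks)
  case (Cons k ks)
  show ?case
  proof (cases "ks = []")
    case True
    then show ?thesis
      using Cons assms(3) by (intro exI[of _ "[x]"]) auto
  next
    case False
    then obtain xs where xs: "nb_walk T xs" "last xs = x" "map p xs = ks"
      using Cons by (auto simp: nb_walk_Cons)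
    then have ne: "xs \<noteq> []" using False by auto
    then have "hd xs \<in> pverts T"
      using nb_walk_in_verts[OF p(2) xs(1)] by auto
    moreover have "(p (hd xs), k) \<in> parcs K"
      using Cons.prems False xs(3) ne by (auto simp: nb_walk_Cons hd_map)
    ultimately obtain w where w: "(hd xs, w) \<in> parcs T" "p w = k"
      using covering_mapD(4)[OF p] by blast
    \<comment> \<open>A backtrack in the lift would project to a backtrack in
      \<open>ks\<close>.\<close>
    have "hd (tl xs) \<noteq> w" if "tl xs \<noteq> []"
    proof -
      have "hd (tl ks) = p (hd (tl xs))" "tl ks \<noteq> []"
        using that by (auto simp: xs(3)[symmetric] map_tl[symmetric] hd_map)
      then show ?thesis
        using Cons.prems False w(2) by (auto simp: nb_walk_Cons)
    qed
    then have "nb_walk T (w # xs)"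
      using w(1) xs(1) ne by (simp add: nb_walk_Cons)
    then show ?thesis
      using xs w ne by (intro exI[of _ "w # xs"]) auto
  qed
qed simp

lemma bij_betw_nb_walk_covering:
  assumes p: "covering_map T K p" "pair_wf_digraph T" and sym: "symmetric (with_proj T)"
    and x: "x \<in> pverts T"
  shows "bij_betw (map p) {xs. nb_walk T xs \<and> last xs = x} {ks. nb_walk K ks \<and> last ks = p x}"
  unfolding bij_betw_def
proof
  show "inj_on (map p) {xs. nb_walk T xs \<and> last xs = x}"
    by (rule inj_onI) (auto intro: nb_walk_lift_unique[OF p])
  have "last (map p xs) = p (last xs)" if "nb_walk T xs" for xs
    using that by (cases "xs = []") (auto simp: last_map)
  then show "map p ` {xs. nb_walk T xs \<and> last xs = x} = {ks. nb_walk K ks \<and> last ks = p x}"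
    using nb_walk_map_covering[OF p sym] nb_walk_lift[OF p x] by fastforce
qed

text \<open>The right-hand side depends on the covering only through the image of \<open>v\<close>.
  Applied to \<open>p \<circ> g\<close>, it makes the orbit count a function of
  \<open>p (g v)\<close> alone.\<close>

lemma card_graph_ball_covering:
  assumes T: "undirected_tree T" and p: "covering_map T K p" and v: "v \<in> pverts T"
  shows "card {x \<in> graph_ball T v r. P (p x)} =
    card {ks. nb_walk K ks \<and> last ks = p v \<and> length ks \<le> Suc r \<and> P (hd ks)}"
proof -
  note T' = undirected_treeD(2,1)[OF T]
  have hd: "hd (map p xs) = p (hd xs)" if "nb_walk T xs" for xs
    using that by (cases "xs = []") (auto simp: hd_map)
  have "bij_betw (map p)
      {xs \<in> {xs. nb_walk T xs \<and> last xs = v}. length xs \<le> Suc r \<and> P (p (hd xs))}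
      {ks \<in> {ks. nb_walk K ks \<and> last ks = p v}. length ks \<le> Suc r \<and> P (hd ks)}"
    using bij_betw_nb_walk_covering[OF p T' v]
    by (rule bij_betw_Collect) (auto simp: hd)
  then show ?thesis
    unfolding card_graph_ball[OF T] by (auto dest!: bij_betw_same_card simp: conj_assoc)
qed

text \<open>Coordinates on the tree: \<open>F v\<close> is the projection to \<open>K\<close> of the
  walk between \<open>v\<close> and \<open>x\<close>. Adjacency is visible in the codes, and the set
  of codes depends only on \<open>p x\<close>, so that encodings based at two points of one fibre
  can be compared.\<close>

lemma nb_walk_encoding:
  assumes T: "undirected_tree T" and p: "covering_map T K p" and x: "x \<in> pverts T"
  obtains F where "bij_betw F (pverts T) {ks. nb_walk K ks \<and> last ks = p x}"
    and "F x = [p x]" and "\<And>v. v \<in> pverts T \<Longrightarrow> hd (F v) = p v"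
    and "\<And>v w. v \<in> pverts T \<Longrightarrow> w \<in> pverts T \<Longrightarrow>
      (v, w) \<in> parcs T \<longleftrightarrow> tl (F w) = F v \<or> tl (F v) = F w"
proof -
  note T' = undirected_treeD[OF T]
  let ?W = "{xs. nb_walk T xs \<and> last xs = x}"
  have hd: "bij_betw hd ?W (pverts T)"
    unfolding bij_betw_def
  proof
    show "inj_on hd ?W"
      by (rule inj_onI) (auto intro: nb_walk_unique[OF T])
    have "hd xs \<in> pverts T" if "nb_walk T xs" for xs
      using nb_walk_in_verts[OF T'(2) that] that by (cases xs) auto
    moreover have "\<exists>xs. nb_walk T xs \<and> last xs = x \<and> hd xs = v" if "v \<in> pverts T" for v
      using T'(6)[OF that x] awalk_imp_nb_walk[OF T'(1,2)] by blast
    ultimately show "hd ` ?W = pverts T" by fastforce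
  qed
  define path where "path = inv_into ?W hd"
  define F where "F = map p \<circ> path"
  have path: "bij_betw path (pverts T) ?W"
    unfolding path_def by (rule bij_betw_inv_into[OF hd])
  have pathW: "nb_walk T (path v)" "last (path v) = x" if "v \<in> pverts T" for v
    using bij_betwE[OF path] that by auto
  have hd_path: "hd (path v) = v" if "v \<in> pverts T" for v
    unfolding path_def using bij_betw_inv_into_right[OF hd that] .
  have path_eqI: "path v = xs" if "nb_walk T xs" "last xs = x" "hd xs = v" for v xs
    unfolding path_def using that bij_betw_inv_into_left[OF hd, of xs] by auto
  have ne: "path v \<noteq> []" if "v \<in> pverts T" for v
    using pathW[OF that] by auto
  have adj: "tl (F w) = F v" if "v \<in> pverts T" "(v, w) \<in> parcs T"
    "tl (path v) = [] \<or> hd (tl (path v)) \<noteq> w" for v w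
  proof -
    have "path w = w # path v"
      using that pathW[OF that(1)] hd_path[OF that(1)] ne[OF that(1)]
      by (intro path_eqI) (auto simp: nb_walk_Cons)
    then show ?thesis by (simp add: F_def)
  qed
  have adj': "tl (F v) = F w" if "v \<in> pverts T"
    "tl (path v) \<noteq> []" "hd (tl (path v)) = w" for v w
  proof -
    have "path w = tl (path v)"
      using that pathW[OF that(1)] ne[OF that(1)]
      by (intro path_eqI) (cases "path v"; auto simp: nb_walk_Cons)+
    then show ?thesis by (simp add: F_def map_tl)
  qed
  \<comment> \<open>Conversely, \<open>tl (path w)\<close> and \<open>path v\<close> have the same
    base point and the same projection, so they agree by uniqueness of lifts.\<close>
  have arc: "(v, w) \<in> parcs T" if vw: "v \<in> pverts T" "w \<in> pverts T" and eq: "tl (F w) = F v" for v w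
  proof -
    have t: "tl (path w) \<noteq> []"
      using eq ne[OF vw(1)] by (auto simp: F_def map_tl[symmetric])
    then have "path w = w # tl (path w)"
      using hd_path[OF vw(2)] by (cases "path w") auto
    then have *: "nb_walk T (tl (path w))" "(hd (tl (path w)), w) \<in> parcs T" "last (tl (path w)) = x"
      using pathW[OF vw(2)] t by (metis nb_walk_Cons, metis nb_walk_Cons, metis last_ConsR)
    have "tl (path w) = path v"
      using * eq pathW[OF vw(1)] by (intro nb_walk_lift_unique[OF p T'(2)]) (auto simp: F_def map_tl)
    then show ?thesis
      using * hd_path[OF vw(1)] by simp
  qed
  show ?thesis
  proof
    show "bij_betw F (pverts T) {ks. nb_walk K ks \<and> last ks = p x}"
      unfolding F_def using path bij_betw_nb_walk_covering[OF p T'(2,1) x] by (rule bij_betw_trans)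
    show "F x = [p x]"
      using path_eqI[of "[x]" x] x by (simp add: F_def)
    show "hd (F v) = p v" if "v \<in> pverts T" for v
      using ne[OF that] hd_path[OF that] by (simp add: F_def hd_map)
    show "(v, w) \<in> parcs T \<longleftrightarrow> tl (F w) = F v \<or> tl (F v) = F w"
      if "v \<in> pverts T" "w \<in> pverts T" for v w
      using that adj adj' arc T'(4) by metis
  qed
qed

section \<open>The deck group and the lattice orbit\<close>

lemma deck_group_transitive:
  assumes T: "undirected_tree T" and p: "covering_map T K p"
    and xy: "x \<in> pverts T" "y \<in> pverts T" "p x = p y"
  shows "\<exists>\<gamma>\<in>deck_group T p. \<gamma> x = y"
proof -
  let ?V = "pverts T"
  obtain F where F: "bij_betw F ?V {ks. nb_walk K ks \<and> last ks = p x}"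
    "F x = [p x]" "\<And>v. v \<in> ?V \<Longrightarrow> hd (F v) = p v"
    "\<And>v w. v \<in> ?V \<Longrightarrow> w \<in> ?V \<Longrightarrow> (v, w) \<in> parcs T \<longleftrightarrow> tl (F w) = F v \<or> tl (F v) = F w"
    using nb_walk_encoding[OF T p xy(1)] by blast
  obtain H where H: "bij_betw H ?V {ks. nb_walk K ks \<and> last ks = p x}"
    "H y = [p x]" "\<And>v. v \<in> ?V \<Longrightarrow> hd (H v) = p v"
    "\<And>v w. v \<in> ?V \<Longrightarrow> w \<in> ?V \<Longrightarrow> (v, w) \<in> parcs T \<longleftrightarrow> tl (H w) = H v \<or> tl (H v) = H w"
    using nb_walk_encoding[OF T p xy(2)] unfolding xy(3)[symmetric] by blast
  \<comment> \<open>A vertex is sent to the vertex with the same code relative to \<open>y\<close>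
    as it has relative to \<open>x\<close>. The restriction is there because elements of
    \<open>Bij\<close> are extensional.\<close>
  define \<gamma> where "\<gamma> = restrict (inv_into ?V H \<circ> F) ?V"
  have "bij_betw (inv_into ?V H \<circ> F) ?V ?V"
    using F(1) bij_betw_inv_into[OF H(1)] by (rule bij_betw_trans)
  then have bij: "bij_betw \<gamma> ?V ?V"
    unfolding \<gamma>_def by (simp cong: bij_betw_cong)
  have H\<gamma>: "H (\<gamma> v) = F v" if "v \<in> ?V" for v
    using that bij_betw_inv_into_right[OF H(1)] bij_betwE[OF F(1)] by (simp add: \<gamma>_def)
  have \<gamma>V: "\<gamma> v \<in> ?V" if "v \<in> ?V" for v
    using that bij_betwE[OF bij] by blast
  have "p (\<gamma> v) = p v" if "v \<in> ?V" for v
    using H(3)[OF \<gamma>V[OF that]] H\<gamma>[OF that] F(3)[OF that] by simp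
  moreover have "\<gamma> \<in> Bij ?V"
    using bij by (simp add: Bij_def \<gamma>_def)
  moreover have "(\<gamma> u, \<gamma> v) \<in> parcs T \<longleftrightarrow> (u, v) \<in> parcs T" if "u \<in> ?V" "v \<in> ?V" for u v
    using F(4)[OF that] H(4)[OF \<gamma>V \<gamma>V, OF that] H\<gamma> that by simp
  ultimately have "\<gamma> \<in> deck_group T p"
    by (simp add: deck_group_def graph_Aut_def)
  moreover have "\<gamma> x = y"
    using H\<gamma>[OF xy(1)] F(2) H(2) bij_betw_imp_inj_on[OF H(1)] \<gamma>V[OF xy(1)] xy(2)
    by (simp add: inj_on_def)
  ultimately show ?thesis by blast
qed

lemma covering_map_comp_Aut:
  assumes p: "covering_map T K p" and T: "pair_wf_digraph T" and g: "g \<in> carrier (graph_Aut T)"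
  shows "covering_map T K (p \<circ> g)"
proof -
  let ?V = "pverts T"
  have bij: "bij_betw g ?V ?V"
    and adj: "\<And>u v. u \<in> ?V \<Longrightarrow> v \<in> ?V \<Longrightarrow> (g u, g v) \<in> parcs T \<longleftrightarrow> (u, v) \<in> parcs T"
    using g by (auto simp: graph_Aut_def Bij_def)
  have gV: "g ` ?V = ?V" using bij by (rule bij_betw_imp_surj_on)
  have "bij_betw (p \<circ> g) {w. (v, w) \<in> parcs T} {w. ((p \<circ> g) v, w) \<in> parcs K}" if v: "v \<in> ?V" for v
  proof (rule bij_betw_trans)
    have sub: "{w. (v, w) \<in> parcs T} \<subseteq> ?V" for v
      using pair_wf_digraph.in_arcsD2[OF T] by auto
    have "g ` {w. (v, w) \<in> parcs T} = {w. (g v, w) \<in> parcs T}"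
    proof
      show "g ` {w. (v, w) \<in> parcs T} \<subseteq> {w. (g v, w) \<in> parcs T}"
        using adj[OF v] sub[of v] by auto
      show "{w. (g v, w) \<in> parcs T} \<subseteq> g ` {w. (v, w) \<in> parcs T}"
      proof
        fix w assume w: "w \<in> {w. (g v, w) \<in> parcs T}"
        then obtain u where "u \<in> ?V" "w = g u"
          using sub[of "g v"] gV by blast
        with w adj[OF v] show "w \<in> g ` {w. (v, w) \<in> parcs T}" by auto
      qed
    qed
    then show "bij_betw g {w. (v, w) \<in> parcs T} {w. (g v, w) \<in> parcs T}"
      using bij_betw_subset[OF bij sub] by blast
    have "g v \<in> ?V" using v gV by blast
    then show "bij_betw p {w. (g v, w) \<in> parcs T} {w. ((p \<circ> g) v, w) \<in> parcs K}"
      using p by (simp add: covering_map_def)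
  qed
  then show ?thesis
    using p gV unfolding covering_map_def image_comp[symmetric] by simp
qed

lemma deck_group_orbit:
  assumes "undirected_tree T" "covering_map T K p" "v \<in> pverts T"
  shows "(\<lambda>\<gamma>. \<gamma> v) ` deck_group T p = {x \<in> pverts T. p x = p v}"
proof
  show "(\<lambda>\<gamma>. \<gamma> v) ` deck_group T p \<subseteq> {x \<in> pverts T. p x = p v}"
    using assms(3) by (auto simp: deck_group_def graph_Aut_in_verts)
  show "{x \<in> pverts T. p x = p v} \<subseteq> (\<lambda>\<gamma>. \<gamma> v) ` deck_group T p"
  proof
    fix x assume "x \<in> {x \<in> pverts T. p x = p v}"
    then show "x \<in> (\<lambda>\<gamma>. \<gamma> v) ` deck_group T p"
      using deck_group_transitive[OF assms(1,2,3), of x] by auto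
  qed
qed

text \<open>By transitivity the orbit of \<open>v\<close> is a whole fibre of \<open>p\<close>, and
  its preimage under \<open>g\<close> is a fibre of the covering \<open>p \<circ> g\<close>.\<close>

lemma lattice_orbit_deck_group:
  assumes "undirected_tree T" "covering_map T K p" "v \<in> pverts T" "g \<in> carrier (graph_Aut T)"
  shows "lattice_orbit T (deck_group T p) v (deck_group T p #>\<^bsub>graph_Aut T\<^esub> g) =
    {x \<in> pverts T. p (g x) = p v}"
proof -
  interpret A: group "graph_Aut T" by (rule group_graph_Aut)
  let ?i = "inv\<^bsub>graph_Aut T\<^esub> g"
  note g = assms(4)
  have one: "\<one>\<^bsub>graph_Aut T\<^esub> x = x" if "x \<in> pverts T" for x
    using that by (simp add: graph_Aut_def BijGroup_def)
  have gi: "g (?i x) = x" "?i (g x) = x" "?i x \<in> pverts T" "g x \<in> pverts T" if x: "x \<in> pverts T" for x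
    using mult_graph_Aut[OF g A.inv_closed[OF g] x] mult_graph_Aut[OF A.inv_closed[OF g] g x]
      one[OF x] graph_Aut_in_verts[OF _ x] g by simp_all
  show ?thesis
    unfolding lattice_orbit_rcoset[OF subgroup_deck_group g assms(3)] deck_group_orbit[OF assms(1-3)]
  proof
    show "?i ` {x \<in> pverts T. p x = p v} \<subseteq> {x \<in> pverts T. p (g x) = p v}"
      using gi by auto
    show "{x \<in> pverts T. p (g x) = p v} \<subseteq> ?i ` {x \<in> pverts T. p x = p v}"
    proof
      fix x assume "x \<in> {x \<in> pverts T. p (g x) = p v}"
      then show "x \<in> ?i ` {x \<in> pverts T. p x = p v}"
        using gi[of x] by (intro image_eqI[of _ _ "g x"]) auto
    qed
  qed
qed


section \<open>Counting non-backtracking walks in the tetrahedron\<close>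

abbreviation nb_walks_to :: "'k pair_pre_digraph \<Rightarrow> 'k \<Rightarrow> nat \<Rightarrow> 'k list set" where
  "nb_walks_to K k n \<equiv> {xs. nb_walk K xs \<and> last xs = k \<and> length xs = Suc n}"

text \<open>Placing the forbidden vertex \<open>j\<close> in front lets \<open>nb_walk\<close>
  itself enforce that the first step does not return to it. In a complete graph the extra arc
  between \<open>a\<close> and \<open>j\<close> costs nothing beyond
  \<open>j \<noteq> a\<close>.\<close>

abbreviation nb_branch :: "'k pair_pre_digraph \<Rightarrow> 'k \<Rightarrow> 'k \<Rightarrow> 'k \<Rightarrow> nat \<Rightarrow> 'k list set" where
  "nb_branch K k j a n \<equiv> {xs. nb_walk K (j # xs) \<and> hd xs = a \<and> last xs = k \<and> length xs = Suc n}"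

text \<open>
  The entries count the non-backtracking walks with \<open>n\<close> steps in the tetrahedron from \<open>a\<close> to \<open>k\<close>
  whose first step avoids a vertex \<open>j \<noteq> a\<close>, in the cases \<open>j = k\<close>, \<open>a = k\<close> and \<open>k \<notin> {j, a}\<close>.
\<close>

fun branch_counts :: "nat \<Rightarrow> nat \<times> nat \<times> nat" where
  "branch_counts 0 = (0, 1, 0)"
| "branch_counts (Suc n) = (let (a, b, c) = branch_counts n in (2 * c, 2 * a, b + c))"

definition branch_count :: "nat \<Rightarrow> 'k \<Rightarrow> 'k \<Rightarrow> 'k \<Rightarrow> nat" where
  "branch_count n k j a = (case branch_counts n of (x, y, z) \<Rightarrow>
     if j = k then x else if a = k then y else z)"

context
  fixes K :: "'k pair_pre_digraph"
  assumes K4: "complete_digraph 4 (with_proj K)"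
begin

lemma K4D: "finite (pverts K)" "card (pverts K) = 4"
    "(u, v) \<in> parcs K \<longleftrightarrow> u \<in> pverts K \<and> v \<in> pverts K \<and> u \<noteq> v" "pair_wf_digraph K"
proof -
  show *: "finite (pverts K)" "card (pverts K) = 4"
    "(u, v) \<in> parcs K \<longleftrightarrow> u \<in> pverts K \<and> v \<in> pverts K \<and> u \<noteq> v" for u v
    using K4 by (auto simp: complete_digraph_pair_def)
  show "pair_wf_digraph K"
    using * by unfold_locales auto
qed

lemma finite_nb_walks: "finite {xs. nb_walk K xs \<and> length xs \<le> n}"
  by (rule finite_subset[OF _ finite_lists_length_le[OF K4D(1), of n]])
    (use nb_walk_in_verts[OF K4D(4)] in auto)

text \<open>Taking \<open>{j}\<close> for \<open>J\<close> gives the recursion for branches; the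
  empty set gives the decomposition of all walks by their first step.\<close>

lemma nb_walks_branch:
  assumes "a \<in> pverts K"
  shows "{xs \<in> nb_walks_to K k (Suc n). hd xs = a \<and> hd (tl xs) \<notin> J} =
    (\<Union>l\<in>pverts K - insert a J. Cons a ` nb_branch K k a l n)"
    (is "?L = ?R")
proof
  show "?L \<subseteq> ?R"
  proof
    fix xs assume xs: "xs \<in> ?L"
    then obtain ys where ys: "xs = a # ys" "ys \<noteq> []"
      by (cases xs) fastforce+
    with xs have "hd ys \<in> pverts K - insert a J"
      by (auto simp: nb_walk_Cons K4D)
    with xs ys show "xs \<in> ?R" by auto
  qed
  show "?R \<subseteq> ?L" by auto
qed

lemma card_branch_sum:
  assumes "a \<in> pverts K"
  shows "card {xs \<in> nb_walks_to K k (Suc n). hd xs = a \<and> hd (tl xs) \<notin> J} =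
    (\<Sum>l\<in>pverts K - insert a J. card (nb_branch K k a l n))"
proof -
  have fin: "finite (nb_branch K k a l n)" (is "finite ?A") for l
  proof -
    have "Cons a ` ?A \<subseteq> {xs. nb_walk K xs \<and> length xs \<le> Suc (Suc n)}" by auto
    then have "finite (Cons a ` ?A)" by (rule finite_subset) (rule finite_nb_walks)
    then show ?thesis by (rule finite_imageD) simp
  qed
  show ?thesis
    unfolding nb_walks_branch[OF assms]
    by (subst card_UN_disjoint) (use K4D(1) fin in \<open>auto simp: card_image\<close>)
qed

lemma card_branch:
  assumes "j \<in> pverts K" "a \<in> pverts K" "k \<in> pverts K" "j \<noteq> a"
  shows "card (nb_branch K k j a n) = branch_count n k j a"
  using assms
proof (induction n arbitrary: j a)
  case 0
  have "nb_branch K k j a 0 = (if a = k then {[a]} else {})"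
    using 0 by (auto simp: length_Suc_conv K4D)
  then show ?case using 0 by (auto simp: branch_count_def)
next
  case (Suc n)
  obtain x y z where b: "branch_counts n = (x, y, z)" by (cases "branch_counts n")
  have "nb_branch K k j a (Suc n) =
      {xs \<in> nb_walks_to K k (Suc n). hd xs = a \<and> hd (tl xs) \<notin> {j}}"
    using Suc.prems by (auto simp: nb_walk_Cons K4D length_Suc_conv)
  also have "card \<dots> = (\<Sum>l\<in>pverts K - {a, j}. branch_count n k a l)"
    unfolding card_branch_sum[OF Suc.prems(2)]
    by (rule sum.cong[OF refl], rule Suc.IH) (use Suc.prems in auto)
  \<comment> \<open>Two vertices other than \<open>a\<close> and \<open>j\<close> remain, and
    \<open>a\<close> is the forbidden vertex of the next branch. Both contribute \<open>z\<close> if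
    \<open>j = k\<close> and \<open>x\<close> if \<open>a = k\<close>; otherwise one of them is
    \<open>k\<close>, contributing \<open>y\<close>, and the other contributes
    \<open>z\<close>.\<close>
  also have "\<dots> = branch_count (Suc n) k j a"
  proof -
    have c: "card (pverts K - {a, j}) = 2"
      using Suc.prems K4D by (simp add: card_Diff_subset)
    consider "j = k" | "a = k" | "j \<noteq> k" "a \<noteq> k" by blast
    then show ?thesis
    proof cases
      case 1
      then have "(\<Sum>l\<in>pverts K - {a, j}. branch_count n k a l) = (\<Sum>l\<in>pverts K - {a, j}. z)"
        using Suc.prems by (intro sum.cong) (auto simp: branch_count_def b)
      with 1 c show ?thesis by (simp add: branch_count_def b)
    next
      case 2
      then have "(\<Sum>l\<in>pverts K - {a, j}. branch_count n k a l) = (\<Sum>l\<in>pverts K - {a, j}. x)"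
        using Suc.prems by (intro sum.cong) (auto simp: branch_count_def b)
      with 2 c Suc.prems show ?thesis by (simp add: branch_count_def b)
    next
      case 3
      then have "card (pverts K - {a, j} - {k}) = 1"
        using c Suc.prems by (simp add: card_Diff_singleton)
      moreover have "(\<Sum>l\<in>pverts K - {a, j}. branch_count n k a l) =
          branch_count n k a k + (\<Sum>l\<in>pverts K - {a, j} - {k}. branch_count n k a l)"
        using 3 Suc.prems K4D(1) by (intro sum.remove) auto
      moreover have "(\<Sum>l\<in>pverts K - {a, j} - {k}. branch_count n k a l) =
          (\<Sum>l\<in>pverts K - {a, j} - {k}. z)"
        using 3 Suc.prems by (intro sum.cong) (auto simp: branch_count_def b)
      ultimately show ?thesis using 3 by (simp add: branch_count_def b)
    qed
  qed
  finally show ?case .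
qed

section \<open>Walks in the tetrahedron with prescribed ends\<close>

lemma card_nb_walks_Suc:
  assumes "a \<in> pverts K" "k \<in> pverts K"
  shows "card {xs \<in> nb_walks_to K k (Suc n). hd xs = a} =
    (case branch_counts n of (x, y, z) \<Rightarrow> if a = k then 3 * x else y + 2 * z)"
proof -
  obtain x y z where b: "branch_counts n = (x, y, z)" by (cases "branch_counts n")
  have c: "card (pverts K - {a}) = 3"
    using assms K4D by (simp add: card_Diff_subset)
  have "card {xs \<in> nb_walks_to K k (Suc n). hd xs = a} = (\<Sum>l\<in>pverts K - {a}. branch_count n k a l)"
    using card_branch_sum[OF assms(1), where J = "{}"] card_branch[of a _ k n] assms
    by (auto intro!: sum.cong)
  \<comment> \<open>All three first steps from \<open>a = k\<close> leave branches that must avoid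
    \<open>k\<close> next; from \<open>a \<noteq> k\<close> one step reaches \<open>k\<close> and
    two do not.\<close>
  also have "\<dots> = (if a = k then 3 * x else y + 2 * z)"
  proof (cases "a = k")
    case True
    with c show ?thesis by (simp add: branch_count_def b)
  next
    case False
    then have "card (pverts K - {a} - {k}) = 2"
      using c assms by (simp add: card_Diff_singleton)
    moreover have "(\<Sum>l\<in>pverts K - {a}. branch_count n k a l) =
        branch_count n k a k + (\<Sum>l\<in>pverts K - {a} - {k}. branch_count n k a l)"
      using False assms K4D(1) by (intro sum.remove) auto
    moreover have "(\<Sum>l\<in>pverts K - {a} - {k}. branch_count n k a l) =
        (\<Sum>l\<in>pverts K - {a} - {k}. z)"
      using False by (intro sum.cong) (auto simp: branch_count_def b)
    ultimately show ?thesis using False by (simp add: branch_count_def b)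
  qed
  finally show ?thesis by (simp add: b)
qed

lemma card_nb_walks_0:
  assumes "a \<in> pverts K"
  shows "card {xs \<in> nb_walks_to K k 0. hd xs = a} = (if a = k then 1 else 0)"
proof -
  have "{xs \<in> nb_walks_to K k 0. hd xs = a} = (if a = k then {[a]} else {})"
    using assms by (auto simp: length_Suc_conv)
  then show ?thesis by simp
qed

lemma card_nb_walks_le_Suc:
  "card {xs. nb_walk K xs \<and> last xs = k \<and> length xs \<le> Suc (Suc r) \<and> hd xs = a} =
   card {xs. nb_walk K xs \<and> last xs = k \<and> length xs \<le> Suc r \<and> hd xs = a} +
   card {xs \<in> nb_walks_to K k (Suc r). hd xs = a}" (is "card ?A = card ?B + card ?C")
proof -
  have "?A = ?B \<union> ?C" by (auto simp: le_Suc_eq)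
  moreover have "finite ?A" by (rule finite_subset[OF _ finite_nb_walks[of "Suc (Suc r)"]]) auto
  moreover have "?B \<inter> ?C = {}" by auto
  ultimately show ?thesis by (simp only: finite_Un card_Un_disjoint)
qed

lemma nb_walks_le_0:
  "{xs. nb_walk K xs \<and> last xs = k \<and> length xs \<le> Suc 0 \<and> hd xs = a} =
    {xs \<in> nb_walks_to K k 0. hd xs = a}"
proof -
  have "nb_walk K xs \<Longrightarrow> length xs \<le> Suc 0 \<longleftrightarrow> length xs = Suc 0" for xs
    by (cases xs) auto
  then show ?thesis by auto
qed

text \<open>The differences over single lengths telescope: the increment
  \<open>6 * z - (2 * x + 2 * (y + z))\<close> is the change of \<open>2 * (x - z)\<close> under the
  recursion. Lengths 0 and 1 cancel, which is why the formula starts at radius one.\<close>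

lemma card_nb_walks_diff:
  assumes "a \<in> pverts K" "k \<in> pverts K" "a \<noteq> k"
  shows "real (card {xs. nb_walk K xs \<and> last xs = a \<and> length xs \<le> Suc (Suc n) \<and> hd xs = a}) -
     real (card {xs. nb_walk K xs \<and> last xs = k \<and> length xs \<le> Suc (Suc n) \<and> hd xs = a}) =
    (case branch_counts n of (x, y, z) \<Rightarrow> 2 * (real x - real z))"
proof (induction n)
  case 0
  show ?case
    unfolding card_nb_walks_le_Suc nb_walks_le_0 card_nb_walks_0[OF assms(1)]
      card_nb_walks_Suc[OF assms(1,1)] card_nb_walks_Suc[OF assms(1,2)]
    using assms by simp
next
  case (Suc n)
  obtain x y z where b: "branch_counts n = (x, y, z)" by (cases "branch_counts n")
  have k: "card {xs \<in> nb_walks_to K a (Suc (Suc n)). hd xs = a} = 3 * (2 * z)"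
    "card {xs \<in> nb_walks_to K k (Suc (Suc n)). hd xs = a} = 2 * x + 2 * (y + z)"
    unfolding card_nb_walks_Suc[OF assms(1,1)] card_nb_walks_Suc[OF assms(1,2)]
    using assms by (simp_all add: b)
  show ?case
    using Suc.IH unfolding card_nb_walks_le_Suc[of _ "Suc n"] k by (simp add: b)
qed

lemma card_nb_walks_ge:
  assumes "k \<in> pverts K"
  shows "2 ^ n \<le> card {xs. nb_walk K xs \<and> last xs = k \<and> length xs \<le> Suc (Suc n)}"
proof -
  obtain x y z where b: "branch_counts n = (x, y, z)" by (cases "branch_counts n")
  \<comment> \<open>Summing over the four possible ends \<open>k\<close> for fixed \<open>j\<close>
    and \<open>a\<close> counts all branches with \<open>n\<close> steps, each step having two
    choices.\<close>
  have "x + y + 2 * z = 2 ^ n"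
    using b
  proof (induction n arbitrary: x y z)
    case (Suc n)
    obtain x' y' z' where "branch_counts n = (x', y', z')" by (cases "branch_counts n")
    then show ?case using Suc.prems Suc.IH[of x' y' z'] by auto
  qed simp
  moreover have "card (nb_walks_to K k (Suc n)) = 3 * x + 3 * (y + 2 * z)"
  proof -
    have fin: "finite (nb_walks_to K k (Suc n))"
      by (rule finite_subset[OF _ finite_nb_walks[of "Suc (Suc n)"]]) auto
    moreover have "finite {xs \<in> nb_walks_to K k (Suc n). hd xs = a}" for a
      by (rule finite_subset[OF _ fin]) auto
    moreover have "hd xs \<in> pverts K" if "nb_walk K xs" for xs
      using nb_walk_in_verts[OF K4D(4) that] that by (cases xs) auto
    ultimately have "card (nb_walks_to K k (Suc n)) =
        (\<Sum>a\<in>pverts K. card {xs \<in> nb_walks_to K k (Suc n). hd xs = a})"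
      using K4D(1)
      by (subst card_UN_disjoint[symmetric]) (auto intro!: arg_cong[where f = card])
    also have "\<dots> = (\<Sum>a\<in>pverts K. if a = k then 3 * x else y + 2 * z)"
      by (intro sum.cong refl, subst card_nb_walks_Suc) (use assms b in auto)
    also have "\<dots> = 3 * x + (\<Sum>a\<in>pverts K - {k}. y + 2 * z)"
      by (subst sum.remove[OF K4D(1) assms]) (auto intro!: sum.cong)
    also have "card (pverts K - {k}) = 3"
      using assms K4D by (simp add: card_Diff_subset)
    then have "(\<Sum>a\<in>pverts K - {k}. y + 2 * z) = 3 * (y + 2 * z)" by simp
    finally show ?thesis .
  qed
  ultimately have "2 ^ n \<le> card (nb_walks_to K k (Suc n))" by simp
  also have "\<dots> \<le> card {xs. nb_walk K xs \<and> last xs = k \<and> length xs \<le> Suc (Suc n)}"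
    by (rule card_mono[OF finite_subset[OF _ finite_nb_walks[of "Suc (Suc n)"]]]) auto
  finally show ?thesis .
qed

end


section \<open>The variance along a subsequence\<close>

text \<open>The mean lies within \<open>d\<close> of every value. Measurability is not among the
  hypotheses, so the bound applies directly to the orbit count; nonnegativity allows
  \<open>f\<close> to be recovered as the root of its square in the non-measurable case.\<close>

lemma (in prob_space) variance_le_oscillation:
  fixes f :: "'a \<Rightarrow> real"
  assumes nonneg: "\<And>x. x \<in> space M \<Longrightarrow> 0 \<le> f x"
    and osc: "\<And>x y. x \<in> space M \<Longrightarrow> y \<in> space M \<Longrightarrow> \<bar>f x - f y\<bar> \<le> d"
  shows "variance f \<le> d\<^sup>2"
proof (cases "f \<in> borel_measurable M")
  case True
  obtain x\<^sub>0 where x\<^sub>0: "x\<^sub>0 \<in> space M" using not_empty by blast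
  have int: "integrable M f"
    using nonneg osc[OF _ x\<^sub>0] True
    by (intro integrable_const_bound[of _ "f x\<^sub>0 + d"] AE_I2) (fastforce simp: abs_le_iff)+
  have "\<bar>f x - expectation f\<bar> \<le> d" if x: "x \<in> space M" for x
  proof -
    have "f x - d \<le> f y \<and> f y \<le> f x + d" if "y \<in> space M" for y
      using osc[OF x that] by (simp add: abs_le_iff)
    then have "f x - d \<le> expectation f" "expectation f \<le> f x + d"
      using int by (auto intro!: integral_ge_const integral_le_const AE_I2)
    then show ?thesis by (simp add: abs_le_iff)
  qed
  then have sq: "(f x - expectation f)\<^sup>2 \<le> d\<^sup>2" if "x \<in> space M" for x
    using that by (metis abs_ge_zero power2_abs power_mono)
  then show ?thesis
    using True by (intro integral_le_const integrable_const_bound[of _ "d\<^sup>2"] AE_I2) auto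
next
  \<comment> \<open>As \<open>f\<close> is nonnegative, \<open>f\<^sup>2\<close> is not measurable either: both integrals have the junk value 0.\<close>
  case False
  then have exp: "expectation f = 0"
    using borel_measurable_integrable not_integrable_integral_eq by blast
  have "\<not> integrable M (\<lambda>x. (f x)\<^sup>2)"
  proof
    assume "integrable M (\<lambda>x. (f x)\<^sup>2)"
    then have "(\<lambda>x. sqrt ((f x)\<^sup>2)) \<in> borel_measurable M"
      by (intro borel_measurable_sqrt[THEN measurable_compose[rotated]] borel_measurable_integrable)
    moreover have "(\<lambda>x. sqrt ((f x)\<^sup>2)) \<in> borel_measurable M \<longleftrightarrow> f \<in> borel_measurable M"
      by (intro measurable_cong) (simp add: nonneg)
    ultimately show False using False by simp
  qed
  then show ?thesis by (simp add: exp not_integrable_integral_eq)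
qed

text \<open>Two powers with exponents at least \<open>N\<close> apart lie within \<open>e\<close> of
  each other along a convergent subsequence. Dividing by the smaller power, of modulus one, brings
  the power with the difference of exponents within \<open>e\<close> of 1.\<close>

lemma Im_power_small:
  fixes z :: complex
  assumes z: "norm z = 1" and "0 < e"
  shows "\<exists>n\<ge>N. \<bar>Im (z ^ n)\<bar> < e"
proof -
  have "\<forall>n. z ^ n \<in> sphere 0 1"
    by (simp add: z norm_power)
  then obtain l r where r: "strict_mono r" "((\<lambda>n. z ^ n) \<circ> r) \<longlonglongrightarrow> l"
    using compact_sphere[of "0::complex" 1] unfolding compact_def by metis
  obtain M where M: "\<And>m n. m \<ge> M \<Longrightarrow> n \<ge> M \<Longrightarrow> norm (z ^ r m - z ^ r n) < e"
    using LIMSEQ_imp_Cauchy[OF r(2)] \<open>0 < e\<close> unfolding Cauchy_iff comp_def by meson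
  have grow: "r M + k \<le> r (M + k)" for k
  proof (induction k)
    case (Suc k)
    have "r (M + k) < r (M + Suc k)" using r(1) by (simp add: strict_mono_def)
    with Suc show ?case by simp
  qed simp
  define d where "d = r (M + N) - r M"
  have rd: "r (M + N) = r M + d" and d: "d \<ge> N"
    using grow[of N] by (auto simp: d_def)
  have "\<bar>Im (z ^ d)\<bar> = \<bar>Im (z ^ d - 1)\<bar>" by simp
  also have "\<dots> \<le> norm (z ^ d - 1)" by (rule abs_Im_le_cmod)
  also have "\<dots> = norm (z ^ r M) * norm (z ^ d - 1)" by (simp add: z norm_power)
  also have "\<dots> = norm (z ^ r (M + N) - z ^ r M)"
    by (simp add: rd power_add norm_mult[symmetric] algebra_simps)
  also have "\<dots> < e" by (rule M) auto
  finally show ?thesis using d by blast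
qed

lemma branch_counts_Im:
  defines "w \<equiv> Complex (- 1 / 2) (sqrt 7 / 2)"
  assumes "branch_counts n = (x, y, z)"
  shows "real z - real x = 2 / sqrt 7 * Im (w ^ n)"
proof -
  let ?L = "\<lambda>n. 2 / sqrt 7 * Im (w ^ n)"
  \<comment> \<open>The number \<open>w\<close> is a root of the characteristic polynomial of the
    recursion, and the factor \<open>2 / sqrt 7\<close> is the inverse of its imaginary part, so
    that \<open>?L 1 = 1\<close>.\<close>
  have w2: "w * w = - w - 2"
    by (simp add: w_def complex_eq_iff)
  have rec: "?L (Suc (Suc n)) = - ?L (Suc n) - 2 * ?L n" for n
  proof -
    have "w ^ Suc (Suc n) = (w * w) * w ^ n" by simp
    also have "\<dots> = - (w ^ Suc n) - 2 * w ^ n" unfolding w2 by (simp add: algebra_simps)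
    finally have "w ^ Suc (Suc n) = - (w ^ Suc n) - 2 * w ^ n" .
    then show ?thesis by (simp only: minus_complex.sel uminus_complex.sel) (simp add: algebra_simps)
  qed
  \<comment> \<open>The recursion has order two, so the induction carries the next term along as
    \<open>y - z\<close>.\<close>
  have "real z - real x = ?L n \<and> real y - real z = ?L (Suc n)"
    using assms(2)
  proof (induction n arbitrary: x y z)
    case 0
    then show ?case by (auto simp: w_def)
  next
    case (Suc n)
    obtain x' y' z' where b: "branch_counts n = (x', y', z')" by (cases "branch_counts n")
    with Suc.prems have "x = 2 * z'" "y = 2 * x'" "z = y' + z'" by auto
    then show ?case unfolding rec[of n] using Suc.IH[OF b] by simp
  qed
  then show ?thesis by simp
qed

theorem theorem1p1:
  fixes T :: "'v pair_pre_digraph" and v\<^sub>0 :: 'v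
    and K :: "'k pair_pre_digraph" and p :: "'v \<Rightarrow> 'k"
    and M :: "('v \<Rightarrow> 'v) set measure"
  assumes "regular_tree 3 T"
    and "v\<^sub>0 \<in> pverts T"
    and "complete_digraph 4 (with_proj K)"
    and "covering_map T K p"
    and "invariant_coset_prob (graph_Aut T) (graph_Aut_topology T) (deck_group T p) M"
  shows "liminf (\<lambda>r::nat. ereal (
      prob_space.variance M
        (\<lambda>C. real (card (lattice_orbit T (deck_group T p) v\<^sub>0 C \<inter> graph_ball T v\<^sub>0 r)))
      / real (card (graph_ball T v\<^sub>0 r)))) = 0"
proof -
  interpret prob_space M
    using assms(5) by (simp add: invariant_coset_prob_def)
  have T: "undirected_tree T"
    using assms(1) by (simp add: regular_tree_def)
  note T' = undirected_treeD[OF T]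
  note K4 = assms(3) and p = assms(4)
  let ?k = "p v\<^sub>0"
  let ?f = "\<lambda>r C. real (card (lattice_orbit T (deck_group T p) v\<^sub>0 C \<inter> graph_ball T v\<^sub>0 r))"
  let ?q = "\<lambda>r. variance (?f r) / real (card (graph_ball T v\<^sub>0 r))"
  let ?N = "\<lambda>r k. card {ks. nb_walk K ks \<and> last ks = k \<and> length ks \<le> Suc r \<and> hd ks = ?k}"
  define w where "w = Complex (- 1 / 2) (sqrt 7 / 2)"
  define z where "z = w / sqrt 2"
  have k: "?k \<in> pverts K"
    using assms(2) covering_mapD(1)[OF p T'(2)] by blast
  have space: "space M = rcosets\<^bsub>graph_Aut T\<^esub> (deck_group T p)"
  proof -
    let ?X = "coset_topology (graph_Aut T) (graph_Aut_topology T) (deck_group T p)"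
    have "space M = space (borel_of ?X)"
      using assms(5) by (intro sets_eq_imp_space_eq) (simp add: invariant_coset_prob_def)
    also have "\<dots> = topspace ?X"
      unfolding borel_of_def by (intro space_measure_of) (auto dest: openin_subset)
    finally show ?thesis
      by (simp add: topspace_coset_topology topspace_graph_Aut_topology)
  qed
  have count: "\<exists>k\<in>pverts K. ?f r C = real (?N r k)" if C: "C \<in> space M" for r C
  proof -
    obtain g where g: "g \<in> carrier (graph_Aut T)" and Cg: "C = deck_group T p #>\<^bsub>graph_Aut T\<^esub> g"
      using C by (auto simp: space RCOSETS_def)
    have pg: "covering_map T K (p \<circ> g)"
      by (rule covering_map_comp_Aut[OF p T'(2) g])
    have "lattice_orbit T (deck_group T p) v\<^sub>0 C \<inter> graph_ball T v\<^sub>0 r =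
        {x \<in> graph_ball T v\<^sub>0 r. (p \<circ> g) x = ?k}"
      unfolding Cg lattice_orbit_deck_group[OF T p assms(2) g] by (auto simp: graph_ball_def)
    then have "?f r C = real (?N r ((p \<circ> g) v\<^sub>0))"
      using card_graph_ball_covering[OF T pg assms(2), of r "\<lambda>k. k = ?k"] by simp
    then show ?thesis
      using covering_mapD(1)[OF pg T'(2) assms(2)] by blast
  qed
  have var: "variance (?f (Suc n)) \<le> 16 / 7 * 2 ^ n * (Im (z ^ n))\<^sup>2" for n
  proof -
    obtain a b c where abc: "branch_counts n = (a, b, c)" by (cases "branch_counts n")
    define A where "A = real (?N (Suc n) ?k)"
    \<comment> \<open>The count when \<open>p (g v\<^sub>0)\<close> differs from
      \<open>p v\<^sub>0\<close>; by \<open>card_nb_walks_diff\<close> it is the same for all three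
      such vertices.\<close>
    define B where "B = A - 2 * (real a - real c)"
    have vals: "?f (Suc n) C \<in> {A, B}" if C: "C \<in> space M" for C
    proof -
      obtain k' where "k' \<in> pverts K" "?f (Suc n) C = real (?N (Suc n) k')"
        using count[OF C] by blast
      then show ?thesis
        using card_nb_walks_diff[OF K4 k, of k' n] by (cases "k' = ?k") (auto simp: A_def B_def abc)
    qed
    have "variance (?f (Suc n)) \<le> \<bar>A - B\<bar>\<^sup>2"
    proof (rule variance_le_oscillation)
      show "\<bar>?f (Suc n) C - ?f (Suc n) D\<bar> \<le> \<bar>A - B\<bar>" if "C \<in> space M" "D \<in> space M" for C D
        using vals[OF that(1)] vals[OF that(2)] by auto
    qed simp
    also have "\<dots> = (A - B)\<^sup>2" by simp
    also have "A - B = - 2 * (real c - real a)" by (simp add: B_def)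
    also have "real c - real a = 2 / sqrt 7 * Im (w ^ n)"
      unfolding w_def by (rule branch_counts_Im[OF abc])
    also have "w ^ n = sqrt 2 ^ n * z ^ n"
      by (simp add: z_def power_divide)
    also have "(- 2 * (2 / sqrt 7 * Im (sqrt 2 ^ n * z ^ n)))\<^sup>2 = 16 / 7 * 2 ^ n * (Im (z ^ n))\<^sup>2"
    proof -
      have "Im (sqrt 2 ^ n * z ^ n) = sqrt 2 ^ n * Im (z ^ n)"
        by (simp flip: of_real_power)
      then show ?thesis
        by (simp add: power_mult_distrib power_divide power2_eq_square
            flip: real_sqrt_mult power_mult_distrib)
    qed
    finally show ?thesis .
  qed
  have ball: "2 ^ n \<le> real (card (graph_ball T v\<^sub>0 (Suc n)))" for n
    using card_graph_ball_covering[OF T p assms(2), of "Suc n" "\<lambda>_. True"]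
      card_nb_walks_ge[OF K4 k, of n]
    by (simp add: numeral_power_le_of_nat_cancel_iff)
  have q: "?q (Suc n) \<le> 16 / 7 * (Im (z ^ n))\<^sup>2" for n
  proof -
    have "?q (Suc n) \<le> (16 / 7 * 2 ^ n * (Im (z ^ n))\<^sup>2) / 2 ^ n"
      by (intro frac_le var ball) auto
    then show ?thesis by simp
  qed
  have nz: "norm z = 1"
    by (simp add: z_def w_def norm_divide cmod_def power_divide)
  show ?thesis
  proof (rule antisym)
    show "0 \<le> liminf (\<lambda>r. ereal (?q r))"
      by (intro Liminf_bounded always_eventually allI) (simp add: divide_nonneg_nonneg)
    show "liminf (\<lambda>r. ereal (?q r)) \<le> 0"
    proof (rule ccontr)
      assume "\<not> liminf (\<lambda>r. ereal (?q r)) \<le> 0"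
      then obtain e where e: "0 < ereal e" "ereal e < liminf (\<lambda>r. ereal (?q r))"
        using ereal_dense2[of 0] by (auto simp: not_le)
      then obtain N where N: "\<And>r. r \<ge> N \<Longrightarrow> e < ?q r"
        using less_LiminfD[OF e(2)] by (auto simp: eventually_sequentially)
      \<comment> \<open>The threshold cancels the factor \<open>16 / 7\<close> in \<open>q\<close>,
        so radius \<open>Suc n\<close> contradicts the eventual lower bound
        \<open>e\<close>.\<close>
      obtain n where n: "n \<ge> N" "\<bar>Im (z ^ n)\<bar> < sqrt (e * 7 / 16)"
        using Im_power_small[OF nz, of "sqrt (e * 7 / 16)" N] e(1) by auto
      have "(Im (z ^ n))\<^sup>2 < e * 7 / 16"
        using n(2) by (metis real_sqrt_abs real_sqrt_less_iff)
      moreover have "e < 16 / 7 * (Im (z ^ n))\<^sup>2"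
        using n(1) by (intro less_le_trans[OF N q]) simp
      ultimately show False by simp
    qed
  qed
qed

end
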